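(* Let $a_1,\dots,a_n>0$, $b_1,\dots,b_n\ge0$ and $v_1,\dots,v_n\ge0$ be real numbers, and let $T_{\mathrm{BV}}(x_1,\dots,x_n)=\sum_{j=1}^n b_jx_j\cdot\mathbf{1}_{x_j\le v_j}$. Let $C_{SA}$ be the optimal value of $$\max_{\hat p}\ T_{\mathrm{BV}}(\hat p(a_1),\dots,\hat p(a_n))$$ over all functions $\hat p:[0,\infty)\to\mathbb{R}$ with $\hat p(x+y)\le\hat p(x)+\hat p(y)$ for all $x,y\ge0$, $\hat p(y)\ge\hat p(x)$ for all $y\ge x\ge0$, and $\hat p(x)\ge0$ for all $x\ge0$. Let $C_{MBP}$ be the optimal value of $$\max_{\mathbf z\in\mathbb{R}^n}\ T_{\mathrm{BV}}(z_1,\dots,z_n)$$ subject to $z_j/a_j\le z_i/a_i$ and $z_j\ge z_i$ for all $i,j$ with $a_j\ge a_i$, and $z_j\ge0$ for all $1\le j\le n$. Then $$C_{SA}/2\le C_{MBP}\le C_{SA}.$$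
   Context: $\mathbf{1}_{x\le v}$ equals $1$ if $x\le v$ and $0$ otherwise. The optimal value is the supremum of the objective over the feasible set. *)

theory Defs
  imports "HOL-Analysis.Analysis"
begin

definition T_BV :: "real^'n \<Rightarrow> real^'n \<Rightarrow> real^'n \<Rightarrow> real" where
  "T_BV b v x = (\<Sum>j\<in>UNIV. b $ j * x $ j * of_bool (x $ j \<le> v $ j))"

text \<open>
  A function on $[0,\infty)$ is represented by a total function of which only the values at
  nonnegative arguments are constrained; its values at negative arguments are never used.
\<close>

definition feasible_SA :: "(real \<Rightarrow> real) set" where
  "feasible_SA = {p. (\<forall>x\<ge>0. \<forall>y\<ge>0. p (x + y) \<le> p x + p y) \<and>
                     (\<forall>x\<ge>0. \<forall>y\<ge>x. p y \<ge> p x) \<and>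
                     (\<forall>x\<ge>0. p x \<ge> 0)}"

definition feasible_MBP :: "real^'n \<Rightarrow> (real^'n) set" where
  "feasible_MBP a = {z. (\<forall>i j. a $ j \<ge> a $ i \<longrightarrow>
                            z $ j / a $ j \<le> z $ i / a $ i \<and> z $ j \<ge> z $ i) \<and>
                        (\<forall>j. z $ j \<ge> 0)}"

definition C_SA :: "real^'n \<Rightarrow> real^'n \<Rightarrow> real^'n \<Rightarrow> real" where
  "C_SA a b v = (SUP p\<in>feasible_SA. T_BV b v (\<chi> j. p (a $ j)))"

definition C_MBP :: "real^'n \<Rightarrow> real^'n \<Rightarrow> real^'n \<Rightarrow> real" where
  "C_MBP a b v = (SUP z\<in>feasible_MBP a. T_BV b v z)"

text \<open>
  Both real suprema are taken over nonempty sets that are bounded above, so they are genuine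
  least upper bounds.
\<close>

lemma T_BV_le:
  assumes "\<And>j. b $ j \<ge> 0" and "\<And>j. v $ j \<ge> 0"
  shows "T_BV b v x \<le> (\<Sum>j\<in>UNIV. b $ j * v $ j)"
  unfolding T_BV_def
  by (rule sum_mono) (auto simp: of_bool_def assms intro: mult_left_mono)

lemma feasible_SA_nonempty: "feasible_SA \<noteq> {}"
  by (auto simp: feasible_SA_def intro!: exI[of _ "\<lambda>_. 0"])

lemma feasible_MBP_nonempty: "feasible_MBP a \<noteq> {}"
  by (auto simp: feasible_MBP_def intro!: exI[of _ "0"])

lemma bdd_above_SA:
  assumes "\<And>j. b $ j \<ge> 0" and "\<And>j. v $ j \<ge> 0"
  shows "bdd_above ((\<lambda>p. T_BV b v (\<chi> j. p (a $ j))) ` feasible_SA)"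
  by (rule bdd_aboveI2) (rule T_BV_le[OF assms])

lemma bdd_above_MBP:
  assumes "\<And>j. b $ j \<ge> 0" and "\<And>j. v $ j \<ge> 0"
  shows "bdd_above (T_BV b v ` feasible_MBP a)"
  by (rule bdd_aboveI2) (rule T_BV_le[OF assms])

end

theory Submission imports Defs begin

text \<open>
  Both inequalities use the upper envelope \<open>q x = max\<^sub>j w\<^sub>j * min 1 (x / a\<^sub>j)\<close> of data \<open>w \<ge> 0\<close>. It is
  nonnegative, nondecreasing and subadditive, and \<open>q x / x\<close> is nonincreasing. If \<open>w\<close> is feasible
  for the finite problem, then \<open>q\<close> interpolates it, \<open>q a\<^sub>i = w\<^sub>i\<close>, which gives \<open>C_MBP \<le> C_SA\<close>.
  If \<open>w\<^sub>j = p a\<^sub>j\<close> for a feasible function \<open>p\<close>, then \<open>p y \<le> \<lceil>y / x\<rceil> * p x \<le> 2 * (y / x) * p x\<close> for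
  \<open>0 < x \<le> y\<close> yields \<open>p a\<^sub>i \<le> q a\<^sub>i \<le> 2 * p a\<^sub>i\<close>. So \<open>z\<^sub>i = q a\<^sub>i / 2\<close> is feasible for the finite
  problem, satisfies the constraint \<open>z\<^sub>i \<le> v\<^sub>i\<close> whenever \<open>p a\<^sub>i\<close> does, and loses at most a factor 2.
\<close>

definition envelope :: "real^'n \<Rightarrow> real^'n \<Rightarrow> real \<Rightarrow> real" where
  "envelope a w x = (MAX j. w $ j * min 1 (x / a $ j))"

lemma envelope_ge: "w $ j * min 1 (x / a $ j) \<le> envelope a w x"
  unfolding envelope_def by (rule Max_ge) auto

lemma envelope_leI:
  assumes "\<And>j. w $ j * min 1 (x / a $ j) \<le> c"
  shows "envelope a w x \<le> c"
  unfolding envelope_def using assms by (subst Max_le_iff) auto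

lemma envelope_ge_nth:
  assumes "a $ j > 0"
  shows "w $ j \<le> envelope a w (a $ j)"
  using envelope_ge[of w j "a $ j" a] assms by simp

context
  fixes a w :: "real^'n"
  assumes a_pos: "\<And>j. a $ j > 0" and w_nonneg: "\<And>j. w $ j \<ge> 0"
begin

lemma envelope_nonneg:
  assumes "x \<ge> 0"
  shows "envelope a w x \<ge> 0"
proof -
  fix j
  have "0 \<le> w $ j * min 1 (x / a $ j)"
    using assms a_pos[of j] w_nonneg[of j] by simp
  also have "\<dots> \<le> envelope a w x" by (rule envelope_ge)
  finally show ?thesis .
qed

lemma envelope_mono:
  assumes "x \<le> y"
  shows "envelope a w x \<le> envelope a w y"
proof (rule envelope_leI)
  fix j
  have "x / a $ j \<le> y / a $ j"
    using assms a_pos[of j] by (simp add: divide_right_mono)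
  then have "w $ j * min 1 (x / a $ j) \<le> w $ j * min 1 (y / a $ j)"
    by (intro mult_left_mono w_nonneg) auto
  also have "\<dots> \<le> envelope a w y" by (rule envelope_ge)
  finally show "w $ j * min 1 (x / a $ j) \<le> envelope a w y" .
qed

text \<open>Each capped term is subadditive because \<open>min 1\<close> is subadditive on
  nonnegative reals, and a maximum of subadditive functions is subadditive.\<close>

lemma envelope_subadditive:
  assumes "x \<ge> 0" "y \<ge> 0"
  shows "envelope a w (x + y) \<le> envelope a w x + envelope a w y"
proof (rule envelope_leI)
  fix j
  have "x / a $ j \<ge> 0" "y / a $ j \<ge> 0"
    using assms a_pos[of j] by auto
  then have "min 1 ((x + y) / a $ j) \<le> min 1 (x / a $ j) + min 1 (y / a $ j)"
    by (auto simp: add_divide_distrib min_def)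
  then have "w $ j * min 1 ((x + y) / a $ j)
      \<le> w $ j * (min 1 (x / a $ j) + min 1 (y / a $ j))"
    by (intro mult_left_mono w_nonneg)
  also have "\<dots> \<le> envelope a w x + envelope a w y"
    unfolding distrib_left by (intro add_mono envelope_ge)
  finally show "w $ j * min 1 ((x + y) / a $ j) \<le> envelope a w x + envelope a w y" .
qed

text \<open>For c \<ge> 1, min 1 (c * t) \<le> c * min 1 t. Clearing the denominators first lets the
  maximum be bounded term by term.\<close>

lemma envelope_divide_antimono:
  assumes "0 < x" "x \<le> y"
  shows "envelope a w y / y \<le> envelope a w x / x"
proof -
  have "envelope a w y \<le> (y / x) * envelope a w x"
  proof (rule envelope_leI)
    fix j
    have "1 \<le> y / x" using assms by simp
    moreover have "(y / x) * (x / a $ j) = y / a $ j" using assms by simp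
    ultimately have "min 1 (y / a $ j) \<le> (y / x) * min 1 (x / a $ j)"
      by (auto simp: min_def)
    then have "w $ j * min 1 (y / a $ j) \<le> w $ j * ((y / x) * min 1 (x / a $ j))"
      by (intro mult_left_mono w_nonneg)
    also have "\<dots> = (y / x) * (w $ j * min 1 (x / a $ j))" by simp
    also have "\<dots> \<le> (y / x) * envelope a w x"
      using assms by (intro mult_left_mono envelope_ge) auto
    finally show "w $ j * min 1 (y / a $ j) \<le> (y / x) * envelope a w x" .
  qed
  then show ?thesis using assms by (simp add: field_simps)
qed

lemma envelope_feasible_SA: "envelope a w \<in> feasible_SA"
  by (simp add: feasible_SA_def envelope_subadditive envelope_mono envelope_nonneg)

lemma envelope_feasible_MBP: "(\<chi> i. envelope a w (a $ i) / 2) \<in> feasible_MBP a"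
proof -
  have "envelope a w (a $ j) / 2 / a $ j \<le> envelope a w (a $ i) / 2 / a $ i"
    if "a $ i \<le> a $ j" for i j
    using envelope_divide_antimono[OF a_pos that] by simp
  then show ?thesis
    by (simp add: feasible_MBP_def envelope_mono envelope_nonneg a_pos less_imp_le)
qed

end

text \<open>The term with j = i attains the value. The two constraints of
  \<open>feasible_MBP\<close> bound the others: monotonicity if a_j \<le> a_i, where the cap 1
  applies, and the ratio condition if a_j > a_i.\<close>

lemma envelope_interpolates:
  assumes a: "\<And>j. a $ j > 0" and z: "z \<in> feasible_MBP a"
  shows "envelope a z (a $ i) = z $ i"
proof (rule antisym)
  show "envelope a z (a $ i) \<le> z $ i"
  proof (rule envelope_leI)
    fix j
    show "z $ j * min 1 (a $ i / a $ j) \<le> z $ i"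
    proof (cases "a $ j \<le> a $ i")
      case True
      then have "z $ j \<le> z $ i" using z by (auto simp: feasible_MBP_def)
      with True show ?thesis using a[of j] by simp
    next
      case False
      then have "z $ j / a $ j \<le> z $ i / a $ i" using z by (auto simp: feasible_MBP_def)
      then have "a $ i * (z $ j / a $ j) \<le> a $ i * (z $ i / a $ i)"
        using a[of i] by (intro mult_left_mono) auto
      with False show ?thesis using a[of i] a[of j] by (simp add: min_def mult.commute)
    qed
  qed
qed (rule envelope_ge_nth[OF a])

lemma feasible_SA_nonneg:
  assumes "p \<in> feasible_SA" "x \<ge> 0"
  shows "p x \<ge> 0"
  using assms by (simp add: feasible_SA_def)

lemma feasible_SA_mono:
  assumes "p \<in> feasible_SA" "0 \<le> x" "x \<le> y"
  shows "p x \<le> p y"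
  using assms by (simp add: feasible_SA_def)

text \<open>Multiples start at 1 because p 0 may be positive, so the bound can fail for the multiple
  0.\<close>

lemma feasible_SA_multiple:
  assumes p: "p \<in> feasible_SA" and x: "x \<ge> 0"
  shows "p (real (Suc n) * x) \<le> real (Suc n) * p x"
proof (induction n)
  case (Suc n)
  have "real (Suc (Suc n)) * x = x + real (Suc n) * x" by (simp add: algebra_simps)
  moreover have "p (x + real (Suc n) * x) \<le> p x + p (real (Suc n) * x)"
    using p x by (simp add: feasible_SA_def)
  ultimately show ?case using Suc by (simp add: algebra_simps)
qed simp

lemma feasible_SA_growth:
  assumes p: "p \<in> feasible_SA" and xy: "0 < x" "x \<le> y"
  shows "p y \<le> 2 * (y / x) * p x"
proof -
  \<comment> \<open>The multiple used is floor + 1: it is at least y / x, and at most y / x + 1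
    \<le> 2 * (y / x) since y / x \<ge> 1.\<close>
  define n where "n = nat \<lfloor>y / x\<rfloor>"
  have ge1: "1 \<le> y / x" using xy by simp
  then have n: "real n \<le> y / x" "y / x \<le> real (Suc n)"
    unfolding n_def by linarith+
  have "p y \<le> p (real (Suc n) * x)"
    using n(2) xy by (intro feasible_SA_mono[OF p]) (auto simp: field_simps)
  also have "\<dots> \<le> real (Suc n) * p x"
    using p xy by (intro feasible_SA_multiple) auto
  also have "\<dots> \<le> 2 * (y / x) * p x"
  proof (rule mult_right_mono)
    show "real (Suc n) \<le> 2 * (y / x)" using n(1) ge1 by linarith
    show "0 \<le> p x" using xy by (intro feasible_SA_nonneg[OF p]) simp
  qed
  finally show ?thesis .
qed

text \<open>Terms with a_j \<le> a_i stay below p a_i by monotonicity; the factor 2 comes from those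
  with a_j > a_i, through \<open>feasible_SA_growth\<close>.\<close>

lemma envelope_feasible_SA_le:
  assumes a: "\<And>j. a $ j > 0" and p: "p \<in> feasible_SA"
  shows "envelope a (\<chi> j. p (a $ j)) (a $ i) \<le> 2 * p (a $ i)"
proof (rule envelope_leI)
  fix j
  have nonneg: "p (a $ i) \<ge> 0" using feasible_SA_nonneg[OF p] a[of i] by simp
  show "(\<chi> j. p (a $ j)) $ j * min 1 (a $ i / a $ j) \<le> 2 * p (a $ i)"
  proof (cases "a $ j \<le> a $ i")
    case True
    then have "p (a $ j) \<le> p (a $ i)"
      using feasible_SA_mono[OF p] a[of j] by simp
    with True nonneg show ?thesis using a[of j] by simp
  next
    case False
    then have "p (a $ j) \<le> 2 * (a $ j / a $ i) * p (a $ i)"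
      using feasible_SA_growth[OF p a] by simp
    with False show ?thesis using a[of i] a[of j]
      by (simp add: min_def pos_divide_le_eq pos_le_divide_eq mult.commute mult.left_commute)
  qed
qed

text \<open>\<open>T_BV\<close> is not monotone, since raising a coordinate past its threshold loses
  its contribution. Hence both bounds: z \<le> x keeps every threshold that x meets, and x \<le> 2 *
  z keeps half of each contribution.\<close>

lemma T_BV_half_le:
  assumes b: "\<And>j. b $ j \<ge> 0" and x: "\<And>j. x $ j \<ge> 0"
    and z: "\<And>j. x $ j \<le> 2 * z $ j" "\<And>j. z $ j \<le> x $ j"
  shows "T_BV b v x / 2 \<le> T_BV b v z"
  unfolding T_BV_def sum_divide_distrib
proof (rule sum_mono)
  fix j
  have z_nonneg: "z $ j \<ge> 0" using x[of j] z(1)[of j] by linarith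
  show "b $ j * x $ j * of_bool (x $ j \<le> v $ j) / 2 \<le> b $ j * z $ j * of_bool (z $ j \<le> v $ j)"
  proof (cases "x $ j \<le> v $ j")
    case True
    then have "z $ j \<le> v $ j" using z(2)[of j] by linarith
    moreover have "b $ j * (x $ j / 2) \<le> b $ j * z $ j"
      using z(1)[of j] by (intro mult_left_mono b) simp
    ultimately show ?thesis using True by simp
  qed (use b[of j] z_nonneg in simp)
qed

theorem proposition3:
  fixes a b v :: "real^'n"
  assumes "\<And>j. a $ j > 0"
    and "\<And>j. b $ j \<ge> 0"
    and "\<And>j. v $ j \<ge> 0"
  shows "C_SA a b v / 2 \<le> C_MBP a b v \<and> C_MBP a b v \<le> C_SA a b v"
proof
  \<comment> \<open>With the factor on the right, the supremum can be bounded one p at a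
    time.\<close>
  have "C_SA a b v \<le> 2 * C_MBP a b v"
    unfolding C_SA_def
  proof (rule cSUP_least[OF feasible_SA_nonempty])
    fix p :: "real \<Rightarrow> real"
    assume p: "p \<in> feasible_SA"
    define w where "w = (\<chi> j. p (a $ j))"
    define z where "z = (\<chi> i. envelope a w (a $ i) / 2)"
    have w: "w $ j \<ge> 0" for j
      using feasible_SA_nonneg[OF p] assms(1)[of j] by (simp add: w_def)
    have z: "z \<in> feasible_MBP a"
      unfolding z_def using assms(1) w by (rule envelope_feasible_MBP)
    have "T_BV b v w / 2 \<le> T_BV b v z"
    proof (rule T_BV_half_le[OF assms(2) w])
      show "w $ j \<le> 2 * z $ j" for j
        using envelope_ge_nth[OF assms(1), of w j] by (simp add: z_def)
      show "z $ j \<le> w $ j" for j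
        using envelope_feasible_SA_le[OF assms(1) p, of j] by (simp add: z_def w_def)
    qed
    also have "\<dots> \<le> C_MBP a b v"
      unfolding C_MBP_def using z bdd_above_MBP[OF assms(2,3)] by (rule cSUP_upper)
    finally show "T_BV b v (\<chi> j. p (a $ j)) \<le> 2 * C_MBP a b v"
      by (simp add: w_def)
  qed
  then show "C_SA a b v / 2 \<le> C_MBP a b v" by simp
next
  show "C_MBP a b v \<le> C_SA a b v"
    unfolding C_MBP_def
  proof (rule cSUP_least[OF feasible_MBP_nonempty])
    fix z
    assume z: "z \<in> feasible_MBP a"
    then have z_nonneg: "z $ j \<ge> 0" for j by (simp add: feasible_MBP_def)
    have "T_BV b v z = T_BV b v (\<chi> j. envelope a z (a $ j))"
      using envelope_interpolates[OF assms(1) z] by simp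
    also have "\<dots> \<le> C_SA a b v"
      unfolding C_SA_def using envelope_feasible_SA[OF assms(1) z_nonneg] bdd_above_SA[OF assms(2,3)]
      by (rule cSUP_upper)
    finally show "T_BV b v z \<le> C_SA a b v" .
  qed
qed

end
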